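(* Let $F:M_1\to M_2$ be a semi-invariant Riemannian submersion from a Kähler manifold $(M_1,g_1,J)$ onto a Riemannian manifold $(M_2,g_2)$. Then the distribution $\ker F_*$ defines a totally geodesic foliation if and only if $$\mathcal{T}_{X_1}\phi X_2+\mathcal{H}\nabla^{1}_{X_1}\omega X_2\in\Gamma(J\mathcal{D}_2)\quad\text{and}\quad \hat{\nabla}_{X_1}\phi X_2+\mathcal{T}_{X_1}\omega X_2\in\Gamma(\mathcal{D}_1)$$ for all $X_1,X_2\in\Gamma(\ker F_* )$.
   Context: A Riemannian submersion $F:(M_1,g_1)\to(M_2,g_2)$ (with $\dim M_1>\dim M_2$) is a smooth surjective map of maximal rank whose differential $F_*$ preserves the lengths of horizontal vectors, i.e. vectors orthogonal to $\ker F_*$. $\mathcal{V}$ and $\mathcal{H}$ denote the orthogonal projections of $TM_1$ onto $\ker F_*$ (vertical) and $(\ker F_* )^\perp$ (horizontal), and $\nabla^1$ is the Levi-Civita connection of $g_1$. $\Gamma(\cdot)$ denotes smooth sections. An almost Hermitian manifold $(M_1,g_1,J)$ satisfies $J^2=-I$ and $g_1(X,Y)=g_1(JX,JY)$; it is Kähler if $(\nabla^1_XJ)Y=0$ for all $X,Y$. A Riemannian submersion $F$ from an almost Hermitian manifold $(M_1,g_1,J)$ onto a Riemannian manifold $(M_2,g_2)$ is called semi-invariant if there is a distribution $\mathcal{D}_1\subseteq\ker F_*$ such that $\ker F_*=\mathcal{D}_1\oplus\mathcal{D}_2$, $J(\mathcal{D}_1)=\mathcal{D}_1$ and $J(\mathcal{D}_2)\subseteq(\ker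 F_* )^\perp$, where $\mathcal{D}_2$ is the orthogonal complement of $\mathcal{D}_1$ in $\ker F_*$. For $V\in\Gamma(\ker F_* )$ write $JV=\phi V+\omega V$ with $\phi V\in\Gamma(\mathcal{D}_1)$, $\omega V\in\Gamma(J\mathcal{D}_2)$. O'Neill's tensor $\mathcal{T}$ is $\mathcal{T}_EG=\mathcal{H}\nabla^1_{\mathcal{V}E}\mathcal{V}G+\mathcal{V}\nabla^1_{\mathcal{V}E}\mathcal{H}G$ for vector fields $E,G$ on $M_1$, and $\hat\nabla_VW=\mathcal{V}\nabla^1_VW$ for $V,W\in\Gamma(\ker F_* )$. A distribution defines a totally geodesic foliation if $\nabla^1_{X}Y$ is a section of it for all sections $X,Y$ of it. *)

theory Defs
  imports "HOL-Analysis.Analysis"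
begin

section \<open>Smooth maps between open subsets of Euclidean spaces\<close>

text \<open>Only meant for open \<open>S\<close>, since the derivatives are taken at full neighbourhoods.\<close>

primrec ck_on :: "nat \<Rightarrow> 'e::euclidean_space set \<Rightarrow> ('e \<Rightarrow> 'v::real_normed_vector) \<Rightarrow> bool" where
  "ck_on 0 S f \<longleftrightarrow> continuous_on S f"
| "ck_on (Suc k) S f \<longleftrightarrow>
     (\<forall>x\<in>S. f differentiable (at x)) \<and>
     (\<forall>v. ck_on k S (\<lambda>x. frechet_derivative f (at x) v))"

definition smooth_on :: "'e::euclidean_space set \<Rightarrow> ('e \<Rightarrow> 'v::real_normed_vector) \<Rightarrow> bool" where
  "smooth_on S f \<longleftrightarrow> (\<forall>k. ck_on k S f)"


section \<open>Smooth manifolds and tangent vectors\<close>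

text \<open>
  The underlying space of a manifold is a whole type \<open>'a\<close>, with its type class topology (Hausdorff
  and second countable); \<open>'e\<close> is the model space, so the dimension is \<open>DIM('e)\<close>.

  Besides the atlas, a manifold carries a choice of a chart around every point. The tangent
  space at \<open>p\<close> is the model space \<open>'e\<close>: a vector \<open>v\<close> stands for the tangent vector at \<open>p\<close> whose
  components with respect to the chosen chart \<open>chart_at M p\<close> are \<open>v\<close>. The components with
  respect to any other chart are obtained by the usual transformation rule (\<open>comps\<close> below), and
  smoothness of tensor fields is always expressed in the charts of the atlas. The choice of
  \<open>chart_at\<close> is thus only a choice of a basis of every single tangent space.
\<close>

record ('a, 'e) chart =
  chart_dom :: "'a set"
  chart_map :: "'a \<Rightarrow> 'e"

record ('a, 'e) manifold =
  atlas :: "('a, 'e) chart set"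
  chart_at :: "'a \<Rightarrow> ('a, 'e) chart"

definition chart_inv :: "('a, 'e) chart \<Rightarrow> 'e \<Rightarrow> 'a" where
  "chart_inv c = inv_into (chart_dom c) (chart_map c)"

definition is_chart ::
    "('a::topological_space, 'e::euclidean_space) chart \<Rightarrow> bool" where
  "is_chart c \<longleftrightarrow> open (chart_dom c) \<and> open (chart_map c ` chart_dom c) \<and>
     homeomorphism (chart_dom c) (chart_map c ` chart_dom c) (chart_map c) (chart_inv c)"

definition smooth_manifold ::
    "('a::{t2_space, second_countable_topology}, 'e::euclidean_space) manifold \<Rightarrow> bool" where
  "smooth_manifold M \<longleftrightarrow>
     (\<forall>c\<in>atlas M. is_chart c) \<and>
     (\<forall>c\<in>atlas M. \<forall>d\<in>atlas M.
        smooth_on (chart_map c ` (chart_dom c \<inter> chart_dom d)) (chart_map d \<circ> chart_inv c)) \<and>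
     (\<forall>p. chart_at M p \<in> atlas M \<and> p \<in> chart_dom (chart_at M p))"

definition smooth_fun ::
    "('a, 'e::euclidean_space) manifold \<Rightarrow> ('a \<Rightarrow> real) \<Rightarrow> bool" where
  "smooth_fun M f \<longleftrightarrow> (\<forall>c\<in>atlas M. smooth_on (chart_map c ` chart_dom c) (f \<circ> chart_inv c))"

definition smooth_map ::
    "('a::topological_space, 'e::euclidean_space) manifold \<Rightarrow>
     ('b::topological_space, 'f::euclidean_space) manifold \<Rightarrow> ('a \<Rightarrow> 'b) \<Rightarrow> bool" where
  "smooth_map M N F \<longleftrightarrow> continuous_on UNIV F \<and>
     (\<forall>c\<in>atlas M. \<forall>d\<in>atlas N.
        smooth_on (chart_map c ` (chart_dom c \<inter> F -` chart_dom d))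
                  (chart_map d \<circ> F \<circ> chart_inv c))"

definition differential ::
    "('a, 'e::euclidean_space) manifold \<Rightarrow> ('b, 'f::euclidean_space) manifold \<Rightarrow>
     ('a \<Rightarrow> 'b) \<Rightarrow> 'a \<Rightarrow> 'e \<Rightarrow> 'f" where
  "differential M N F p =
     frechet_derivative (chart_map (chart_at N (F p)) \<circ> F \<circ> chart_inv (chart_at M p))
       (at (chart_map (chart_at M p) p))"

text \<open>
  \<open>comps M c p v\<close>: the components in the chart \<open>c\<close> of the tangent vector \<open>v\<close> at \<open>p\<close>;
  \<open>of_comps M c p u\<close>: the tangent vector at \<open>p\<close> whose components in the chart \<open>c\<close> are \<open>u\<close>.
\<close>

definition comps ::
    "('a, 'e::euclidean_space) manifold \<Rightarrow> ('a, 'e) chart \<Rightarrow> 'a \<Rightarrow> 'e \<Rightarrow> 'e" where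
  "comps M c p =
     frechet_derivative (chart_map c \<circ> chart_inv (chart_at M p))
       (at (chart_map (chart_at M p) p))"

definition of_comps ::
    "('a, 'e::euclidean_space) manifold \<Rightarrow> ('a, 'e) chart \<Rightarrow> 'a \<Rightarrow> 'e \<Rightarrow> 'e" where
  "of_comps M c p =
     frechet_derivative (chart_map (chart_at M p) \<circ> chart_inv c) (at (chart_map c p))"


section \<open>Vector fields\<close>

definition local_rep ::
    "('a, 'e::euclidean_space) manifold \<Rightarrow> ('a, 'e) chart \<Rightarrow> ('a \<Rightarrow> 'e) \<Rightarrow> 'e \<Rightarrow> 'e" where
  "local_rep M c X = (\<lambda>x. comps M c (chart_inv c x) (X (chart_inv c x)))"

definition smooth_vf_on ::
    "('a, 'e::euclidean_space) manifold \<Rightarrow> 'a set \<Rightarrow> ('a \<Rightarrow> 'e) \<Rightarrow> bool" where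
  "smooth_vf_on M U X \<longleftrightarrow>
     (\<forall>c\<in>atlas M. smooth_on (chart_map c ` (chart_dom c \<inter> U)) (local_rep M c X))"

abbreviation smooth_vf :: "('a, 'e::euclidean_space) manifold \<Rightarrow> ('a \<Rightarrow> 'e) \<Rightarrow> bool" where
  "smooth_vf M X \<equiv> smooth_vf_on M UNIV X"

definition vf_apply ::
    "('a, 'e::euclidean_space) manifold \<Rightarrow> ('a \<Rightarrow> 'e) \<Rightarrow> ('a \<Rightarrow> real) \<Rightarrow> 'a \<Rightarrow> real" where
  "vf_apply M X f p =
     frechet_derivative (f \<circ> chart_inv (chart_at M p)) (at (chart_map (chart_at M p) p)) (X p)"

text \<open>The coordinate formula \<open>[X,Y]\<^sup>i = X\<^sup>j \<partial>\<^sub>j Y\<^sup>i - Y\<^sup>j \<partial>\<^sub>j X\<^sup>i\<close>, at \<open>p\<close> in the chart \<open>chart_at M p\<close>.\<close>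

definition lie_bracket ::
    "('a, 'e::euclidean_space) manifold \<Rightarrow> ('a \<Rightarrow> 'e) \<Rightarrow> ('a \<Rightarrow> 'e) \<Rightarrow> 'a \<Rightarrow> 'e" where
  "lie_bracket M X Y p =
     (let c = chart_at M p; x = chart_map c p
      in frechet_derivative (local_rep M c Y) (at x) (X p)
         - frechet_derivative (local_rep M c X) (at x) (Y p))"


section \<open>Riemannian metrics and the Levi-Civita connection\<close>

definition riemannian_metric ::
    "('a, 'e::euclidean_space) manifold \<Rightarrow> ('a \<Rightarrow> 'e \<Rightarrow> 'e \<Rightarrow> real) \<Rightarrow> bool" where
  "riemannian_metric M g \<longleftrightarrow>
     (\<forall>p. bilinear (g p)) \<and>
     (\<forall>p u v. g p u v = g p v u) \<and>
     (\<forall>p v. v \<noteq> 0 \<longrightarrow> g p v v > 0) \<and>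
     (\<forall>c\<in>atlas M. \<forall>u v. smooth_on (chart_map c ` chart_dom c)
        (\<lambda>x. let p = chart_inv c x in g p (of_comps M c p u) (of_comps M c p v)))"

definition riemannian_manifold ::
    "('a::{t2_space, second_countable_topology}, 'e::euclidean_space) manifold \<Rightarrow>
     ('a \<Rightarrow> 'e \<Rightarrow> 'e \<Rightarrow> real) \<Rightarrow> bool" where
  "riemannian_manifold M g \<longleftrightarrow> smooth_manifold M \<and> riemannian_metric M g"

definition affine_connection ::
    "('a, 'e::euclidean_space) manifold \<Rightarrow> (('a \<Rightarrow> 'e) \<Rightarrow> ('a \<Rightarrow> 'e) \<Rightarrow> 'a \<Rightarrow> 'e) \<Rightarrow> bool" where
  "affine_connection M nabla \<longleftrightarrow>
     (\<forall>X Y. smooth_vf M X \<longrightarrow> smooth_vf M Y \<longrightarrow> smooth_vf M (nabla X Y)) \<and>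
     (\<forall>X X' Y. smooth_vf M X \<longrightarrow> smooth_vf M X' \<longrightarrow> smooth_vf M Y \<longrightarrow>
        nabla (\<lambda>p. X p + X' p) Y = (\<lambda>p. nabla X Y p + nabla X' Y p)) \<and>
     (\<forall>f X Y. smooth_fun M f \<longrightarrow> smooth_vf M X \<longrightarrow> smooth_vf M Y \<longrightarrow>
        nabla (\<lambda>p. f p *\<^sub>R X p) Y = (\<lambda>p. f p *\<^sub>R nabla X Y p)) \<and>
     (\<forall>X Y Y'. smooth_vf M X \<longrightarrow> smooth_vf M Y \<longrightarrow> smooth_vf M Y' \<longrightarrow>
        nabla X (\<lambda>p. Y p + Y' p) = (\<lambda>p. nabla X Y p + nabla X Y' p)) \<and>
     (\<forall>f X Y. smooth_fun M f \<longrightarrow> smooth_vf M X \<longrightarrow> smooth_vf M Y \<longrightarrow>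
        nabla X (\<lambda>p. f p *\<^sub>R Y p) = (\<lambda>p. vf_apply M X f p *\<^sub>R Y p + f p *\<^sub>R nabla X Y p))"

text \<open>
  The Levi-Civita connection is the unique torsion-free metric connection on smooth vector fields;
  nothing is said about the value of \<open>nabla\<close> on non-smooth arguments.
\<close>

definition levi_civita ::
    "('a, 'e::euclidean_space) manifold \<Rightarrow> ('a \<Rightarrow> 'e \<Rightarrow> 'e \<Rightarrow> real) \<Rightarrow>
     (('a \<Rightarrow> 'e) \<Rightarrow> ('a \<Rightarrow> 'e) \<Rightarrow> 'a \<Rightarrow> 'e) \<Rightarrow> bool" where
  "levi_civita M g nabla \<longleftrightarrow>
     affine_connection M nabla \<and>
     (\<forall>X Y. smooth_vf M X \<longrightarrow> smooth_vf M Y \<longrightarrow>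
        (\<forall>p. nabla X Y p - nabla Y X p = lie_bracket M X Y p)) \<and>
     (\<forall>X Y Z. smooth_vf M X \<longrightarrow> smooth_vf M Y \<longrightarrow> smooth_vf M Z \<longrightarrow>
        (\<forall>p. vf_apply M X (\<lambda>q. g q (Y q) (Z q)) p
             = g p (nabla X Y p) (Z p) + g p (Y p) (nabla X Z p)))"


section \<open>Almost Hermitian and Kaehler manifolds\<close>

definition smooth_endomorphism ::
    "('a, 'e::euclidean_space) manifold \<Rightarrow> ('a \<Rightarrow> 'e \<Rightarrow> 'e) \<Rightarrow> bool" where
  "smooth_endomorphism M J \<longleftrightarrow>
     (\<forall>p. linear (J p)) \<and>
     (\<forall>c\<in>atlas M. \<forall>u. smooth_on (chart_map c ` chart_dom c)
        (\<lambda>x. let p = chart_inv c x in comps M c p (J p (of_comps M c p u))))"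

definition almost_hermitian_manifold ::
    "('a::{t2_space, second_countable_topology}, 'e::euclidean_space) manifold \<Rightarrow>
     ('a \<Rightarrow> 'e \<Rightarrow> 'e \<Rightarrow> real) \<Rightarrow> ('a \<Rightarrow> 'e \<Rightarrow> 'e) \<Rightarrow> bool" where
  "almost_hermitian_manifold M g J \<longleftrightarrow>
     riemannian_manifold M g \<and> smooth_endomorphism M J \<and>
     (\<forall>p v. J p (J p v) = - v) \<and>
     (\<forall>p u v. g p u v = g p (J p u) (J p v))"

definition cov_deriv_endo ::
    "(('a \<Rightarrow> 'e) \<Rightarrow> ('a \<Rightarrow> 'e) \<Rightarrow> 'a \<Rightarrow> 'e::euclidean_space) \<Rightarrow> ('a \<Rightarrow> 'e \<Rightarrow> 'e) \<Rightarrow>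
     ('a \<Rightarrow> 'e) \<Rightarrow> ('a \<Rightarrow> 'e) \<Rightarrow> 'a \<Rightarrow> 'e" where
  "cov_deriv_endo nabla J X Y p = nabla X (\<lambda>q. J q (Y q)) p - J p (nabla X Y p)"

definition kaehler_manifold ::
    "('a::{t2_space, second_countable_topology}, 'e::euclidean_space) manifold \<Rightarrow>
     ('a \<Rightarrow> 'e \<Rightarrow> 'e \<Rightarrow> real) \<Rightarrow> ('a \<Rightarrow> 'e \<Rightarrow> 'e) \<Rightarrow>
     (('a \<Rightarrow> 'e) \<Rightarrow> ('a \<Rightarrow> 'e) \<Rightarrow> 'a \<Rightarrow> 'e) \<Rightarrow> bool" where
  "kaehler_manifold M g J nabla \<longleftrightarrow>
     almost_hermitian_manifold M g J \<and> levi_civita M g nabla \<and>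
     (\<forall>X Y. smooth_vf M X \<longrightarrow> smooth_vf M Y \<longrightarrow> (\<forall>p. cov_deriv_endo nabla J X Y p = 0))"


section \<open>Distributions\<close>

text \<open>
  A distribution is a smooth subbundle of the tangent bundle, i.e. it has a smooth local frame
  around every point. The rank is locally constant, hence constant if the manifold is connected;
  rank \<open>0\<close> is allowed.
\<close>

definition distribution ::
    "('a::topological_space, 'e::euclidean_space) manifold \<Rightarrow> ('a \<Rightarrow> 'e set) \<Rightarrow> bool" where
  "distribution M D \<longleftrightarrow>
     (\<forall>p. \<exists>U k (E :: nat \<Rightarrow> 'a \<Rightarrow> 'e). open U \<and> p \<in> U \<and>
        (\<forall>i<k. smooth_vf_on M U (E i)) \<and>
        (\<forall>q\<in>U. D q = span ((\<lambda>i. E i q) ` {..<k}) \<and> dim (D q) = k))"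

definition sections ::
    "('a, 'e::euclidean_space) manifold \<Rightarrow> ('a \<Rightarrow> 'e set) \<Rightarrow> ('a \<Rightarrow> 'e) set" where
  "sections M D = {X. smooth_vf M X \<and> (\<forall>p. X p \<in> D p)}"

definition totally_geodesic_foliation ::
    "('a, 'e::euclidean_space) manifold \<Rightarrow> (('a \<Rightarrow> 'e) \<Rightarrow> ('a \<Rightarrow> 'e) \<Rightarrow> 'a \<Rightarrow> 'e) \<Rightarrow>
     ('a \<Rightarrow> 'e set) \<Rightarrow> bool" where
  "totally_geodesic_foliation M nabla D \<longleftrightarrow>
     (\<forall>X\<in>sections M D. \<forall>Y\<in>sections M D. nabla X Y \<in> sections M D)"

definition orth_compl :: "('e::euclidean_space \<Rightarrow> 'e \<Rightarrow> real) \<Rightarrow> 'e set \<Rightarrow> 'e set" where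
  "orth_compl h S = {v. \<forall>w\<in>S. h v w = 0}"

definition orth_proj :: "('e::euclidean_space \<Rightarrow> 'e \<Rightarrow> real) \<Rightarrow> 'e set \<Rightarrow> 'e \<Rightarrow> 'e" where
  "orth_proj h S v = (THE w. w \<in> S \<and> v - w \<in> orth_compl h S)"


section \<open>Riemannian submersions\<close>

definition vert ::
    "('a, 'e::euclidean_space) manifold \<Rightarrow> ('b, 'f::euclidean_space) manifold \<Rightarrow>
     ('a \<Rightarrow> 'b) \<Rightarrow> 'a \<Rightarrow> 'e set" where
  "vert M N F p = {v. differential M N F p v = 0}"

definition horiz ::
    "('a, 'e::euclidean_space) manifold \<Rightarrow> ('a \<Rightarrow> 'e \<Rightarrow> 'e \<Rightarrow> real) \<Rightarrow>
     ('b, 'f::euclidean_space) manifold \<Rightarrow> ('a \<Rightarrow> 'b) \<Rightarrow> 'a \<Rightarrow> 'e set" where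
  "horiz M g N F p = orth_compl (g p) (vert M N F p)"

definition riemannian_submersion ::
    "('a::{t2_space, second_countable_topology}, 'e::euclidean_space) manifold \<Rightarrow>
     ('a \<Rightarrow> 'e \<Rightarrow> 'e \<Rightarrow> real) \<Rightarrow>
     ('b::{t2_space, second_countable_topology}, 'f::euclidean_space) manifold \<Rightarrow>
     ('b \<Rightarrow> 'f \<Rightarrow> 'f \<Rightarrow> real) \<Rightarrow> ('a \<Rightarrow> 'b) \<Rightarrow> bool" where
  "riemannian_submersion M g N h F \<longleftrightarrow>
     riemannian_manifold M g \<and> riemannian_manifold N h \<and> DIM('e) > DIM('f) \<and>
     smooth_map M N F \<and> surj F \<and>
     (\<forall>p. surj (differential M N F p)) \<and>
     (\<forall>p. \<forall>v\<in>horiz M g N F p.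
        h (F p) (differential M N F p v) (differential M N F p v) = g p v v)"

definition ver ::
    "('a, 'e::euclidean_space) manifold \<Rightarrow> ('a \<Rightarrow> 'e \<Rightarrow> 'e \<Rightarrow> real) \<Rightarrow>
     ('b, 'f::euclidean_space) manifold \<Rightarrow> ('a \<Rightarrow> 'b) \<Rightarrow> ('a \<Rightarrow> 'e) \<Rightarrow> 'a \<Rightarrow> 'e" where
  "ver M g N F E p = orth_proj (g p) (vert M N F p) (E p)"

definition hor ::
    "('a, 'e::euclidean_space) manifold \<Rightarrow> ('a \<Rightarrow> 'e \<Rightarrow> 'e \<Rightarrow> real) \<Rightarrow>
     ('b, 'f::euclidean_space) manifold \<Rightarrow> ('a \<Rightarrow> 'b) \<Rightarrow> ('a \<Rightarrow> 'e) \<Rightarrow> 'a \<Rightarrow> 'e" where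
  "hor M g N F E p = orth_proj (g p) (horiz M g N F p) (E p)"

definition oneill_T ::
    "('a, 'e::euclidean_space) manifold \<Rightarrow> ('a \<Rightarrow> 'e \<Rightarrow> 'e \<Rightarrow> real) \<Rightarrow>
     (('a \<Rightarrow> 'e) \<Rightarrow> ('a \<Rightarrow> 'e) \<Rightarrow> 'a \<Rightarrow> 'e) \<Rightarrow>
     ('b, 'f::euclidean_space) manifold \<Rightarrow> ('a \<Rightarrow> 'b) \<Rightarrow>
     ('a \<Rightarrow> 'e) \<Rightarrow> ('a \<Rightarrow> 'e) \<Rightarrow> 'a \<Rightarrow> 'e" where
  "oneill_T M g nabla N F E G p =
     hor M g N F (nabla (ver M g N F E) (ver M g N F G)) p
     + ver M g N F (nabla (ver M g N F E) (hor M g N F G)) p"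

definition nabla_hat ::
    "('a, 'e::euclidean_space) manifold \<Rightarrow> ('a \<Rightarrow> 'e \<Rightarrow> 'e \<Rightarrow> real) \<Rightarrow>
     (('a \<Rightarrow> 'e) \<Rightarrow> ('a \<Rightarrow> 'e) \<Rightarrow> 'a \<Rightarrow> 'e) \<Rightarrow>
     ('b, 'f::euclidean_space) manifold \<Rightarrow> ('a \<Rightarrow> 'b) \<Rightarrow>
     ('a \<Rightarrow> 'e) \<Rightarrow> ('a \<Rightarrow> 'e) \<Rightarrow> 'a \<Rightarrow> 'e" where
  "nabla_hat M g nabla N F V W = ver M g N F (nabla V W)"


section \<open>Semi-invariant Riemannian submersions\<close>

definition orth_compl_in_vert ::
    "('a, 'e::euclidean_space) manifold \<Rightarrow> ('a \<Rightarrow> 'e \<Rightarrow> 'e \<Rightarrow> real) \<Rightarrow>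
     ('b, 'f::euclidean_space) manifold \<Rightarrow> ('a \<Rightarrow> 'b) \<Rightarrow> ('a \<Rightarrow> 'e set) \<Rightarrow> 'a \<Rightarrow> 'e set" where
  "orth_compl_in_vert M g N F D1 p = vert M N F p \<inter> orth_compl (g p) (D1 p)"

text \<open>
  \<open>D1\<close> is the witness required by the definition of a semi-invariant submersion, and
  \<open>D2\<close> is determined by it. (\<open>D1\<close> is itself determined by \<open>F\<close>, as \<open>ker F\<^sub>* \<inter> J (ker F\<^sub>*)\<close>.)
\<close>

definition semi_invariant_submersion ::
    "('a::{t2_space, second_countable_topology}, 'e::euclidean_space) manifold \<Rightarrow>
     ('a \<Rightarrow> 'e \<Rightarrow> 'e \<Rightarrow> real) \<Rightarrow> ('a \<Rightarrow> 'e \<Rightarrow> 'e) \<Rightarrow>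
     ('b::{t2_space, second_countable_topology}, 'f::euclidean_space) manifold \<Rightarrow>
     ('b \<Rightarrow> 'f \<Rightarrow> 'f \<Rightarrow> real) \<Rightarrow> ('a \<Rightarrow> 'b) \<Rightarrow> ('a \<Rightarrow> 'e set) \<Rightarrow> bool" where
  "semi_invariant_submersion M g J N h F D1 \<longleftrightarrow>
     almost_hermitian_manifold M g J \<and>
     riemannian_submersion M g N h F \<and>
     distribution M D1 \<and>
     (let D2 = orth_compl_in_vert M g N F D1 in
        \<forall>p. D1 p \<subseteq> vert M N F p \<and>
            vert M N F p = {v + w | v w. v \<in> D1 p \<and> w \<in> D2 p} \<and> D1 p \<inter> D2 p = {0} \<and>
            J p ` D1 p = D1 p \<and>
            J p ` D2 p \<subseteq> horiz M g N F p)"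

text \<open>The components in \<open>JV = \<phi>V + \<omega>V\<close>, for a vertical vector field \<open>V\<close>.\<close>

definition phi ::
    "('a \<Rightarrow> 'e \<Rightarrow> 'e) \<Rightarrow> ('a \<Rightarrow> 'e set) \<Rightarrow> ('a \<Rightarrow> 'e set) \<Rightarrow>
     ('a \<Rightarrow> 'e) \<Rightarrow> 'a \<Rightarrow> 'e::euclidean_space" where
  "phi J D1 D2 V p = (THE v. v \<in> D1 p \<and> J p (V p) - v \<in> J p ` D2 p)"

definition omega ::
    "('a \<Rightarrow> 'e \<Rightarrow> 'e) \<Rightarrow> ('a \<Rightarrow> 'e set) \<Rightarrow> ('a \<Rightarrow> 'e set) \<Rightarrow>
     ('a \<Rightarrow> 'e) \<Rightarrow> 'a \<Rightarrow> 'e::euclidean_space" where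
  "omega J D1 D2 V p = (THE w. w \<in> J p ` D2 p \<and> J p (V p) - w \<in> D1 p)"

end

theory Submission
  imports Defs
begin

text \<open>
  Let \<open>X\<^sub>1\<close>, \<open>X\<^sub>2\<close> be vertical vector fields. Since \<open>J\<close> is parallel,
  \<open>W = J \<nabla>\<^bsub>X\<^sub>1\<^esub> X\<^sub>2 = \<nabla>\<^bsub>X\<^sub>1\<^esub> (J X\<^sub>2) = \<nabla>\<^bsub>X\<^sub>1\<^esub> \<phi>X\<^sub>2 + \<nabla>\<^bsub>X\<^sub>1\<^esub> \<omega>X\<^sub>2\<close>. Because \<open>\<phi>X\<^sub>2\<close> is vertical
  and \<open>\<omega>X\<^sub>2\<close> is horizontal, half of the terms in O'Neill's tensor drop out, and the two expressions
  of the theorem are exactly the horizontal and the vertical part of \<open>W\<close>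
  (\<open>gauss_weingarten\<close>). On the other hand \<open>J\<close> maps \<open>ker F\<^sub>* = D\<^sub>1 \<oplus> D\<^sub>2\<close> bijectively onto
  \<open>D\<^sub>1 \<oplus> J D\<^sub>2\<close>, where \<open>D\<^sub>1\<close> is vertical and \<open>J D\<^sub>2\<close> horizontal. So a vector field \<open>Z\<close> is vertical
  if and only if the vertical part of \<open>J Z\<close> lies in \<open>D\<^sub>1\<close> and its horizontal part in \<open>J D\<^sub>2\<close>
  (\<open>section_vert_iff\<close>). Taking \<open>Z = \<nabla>\<^bsub>X\<^sub>1\<^esub> X\<^sub>2\<close> proves the theorem, for each pair \<open>X\<^sub>1\<close>, \<open>X\<^sub>2\<close> separately.

  The analytic content is smoothness: the connection axioms apply to \<open>\<phi>X\<^sub>2\<close> and \<open>\<omega>X\<^sub>2\<close> only once these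
  are known to be smooth, and the two parts of \<open>J Z\<close> have to be smooth to be sections. Both are
  instances of the same fact. For a vertical field \<open>V\<close>, the field \<open>\<phi>V\<close> is the orthogonal projection
  of \<open>J V\<close> to the distribution \<open>D\<^sub>1\<close>, and \<open>\<omega>V = J V - \<phi>V\<close>; if \<open>Z\<close> is vertical, the vertical and
  the horizontal part of \<open>J Z\<close> are \<open>\<phi>Z\<close> and \<open>\<omega>Z\<close>. Orthogonal projection to a distribution preserves
  smoothness (\<open>smooth_projection_to_distribution\<close>), because in a smooth local frame it is computed by
  Gram-Schmidt orthogonalisation, which uses only sums, products and quotients with nonzero denominator
  of smooth functions.
\<close>

section \<open>Calculus of smooth maps on open sets\<close>

lemma frechet_derivative_eq:
  "(f has_derivative f') (at x) \<Longrightarrow> frechet_derivative f (at x) v = f' v"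
  using frechet_derivative_at[of f f' x] by simp

lemma ck_on_Suc_imp: "ck_on (Suc k) S f \<Longrightarrow> ck_on k S f"
proof (induction k arbitrary: f)
  case 0
  then show ?case
    by (auto intro!: differentiable_imp_continuous_on differentiable_at_imp_differentiable_on)
next
  case (Suc k)
  then show ?case by (metis ck_on.simps(2))
qed

lemma ck_on_subset: "T \<subseteq> S \<Longrightarrow> ck_on k S f \<Longrightarrow> ck_on k T f"
  by (induction k arbitrary: f) (auto intro: continuous_on_subset)

lemma ck_on_cong:
  assumes "open S" "\<And>x. x \<in> S \<Longrightarrow> f x = g x" "ck_on k S f"
  shows "ck_on k S g"
  using assms(2,3)
proof (induction k arbitrary: f g)
  case 0
  then show ?case by (auto cong: continuous_on_cong)
next
  case (Suc k)
  have "frechet_derivative f (at x) = frechet_derivative g (at x)" if "x \<in> S" for x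
    using Suc.prems that
    by (intro frechet_derivative_transform_within_open[OF _ \<open>open S\<close>]) auto
  moreover have "g differentiable (at x)" if "x \<in> S" for x
    using Suc.prems that
    by (metis ck_on.simps(2) differentiable_def has_derivative_transform_within_open \<open>open S\<close>)
  ultimately show ?case
    using Suc.prems Suc.IH[of "\<lambda>x. frechet_derivative f (at x) v" for v] by simp
qed

text \<open>
  Smoothness is a local property since the derivatives are taken at full neighbourhoods;
  this is what allows local frames to be used below.
\<close>

lemma ck_on_local:
  assumes "\<And>x. x \<in> S \<Longrightarrow> \<exists>T. open T \<and> x \<in> T \<and> ck_on k T f"
  shows "ck_on k S f"
  using assms
proof (induction k arbitrary: f)
  case 0
  have "isCont f x" if x: "x \<in> S" for x
    using 0[OF x] by (auto simp: continuous_on_eq_continuous_at)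
  then show ?case by (simp add: continuous_at_imp_continuous_on)
next
  case (Suc k)
  then show ?case by (metis ck_on.simps(2))
qed

lemma ck_on_const: "ck_on k S (\<lambda>x. c)"
  by (induction k arbitrary: c) auto

lemma ck_on_add:
  assumes "open S" "ck_on k S f" "ck_on k S g"
  shows "ck_on k S (\<lambda>x. f x + g x)"
  using assms(2,3)
proof (induction k arbitrary: f g)
  case 0
  then show ?case by (auto intro: continuous_intros)
next
  case (Suc k)
  have der: "((\<lambda>x. f x + g x) has_derivative
      (\<lambda>v. frechet_derivative f (at x) v + frechet_derivative g (at x) v)) (at x)"
    if "x \<in> S" for x
    using Suc.prems that
    by (intro has_derivative_add frechet_derivative_works[THEN iffD1]) auto
  have eq: "frechet_derivative (\<lambda>x. f x + g x) (at x) v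
      = frechet_derivative f (at x) v + frechet_derivative g (at x) v" if "x \<in> S" for x v
    by (rule frechet_derivative_eq[OF der[OF that]])
  have sm: "ck_on k S (\<lambda>x. frechet_derivative f (at x) v + frechet_derivative g (at x) v)" for v
    using Suc.prems by (intro Suc.IH) simp_all
  have "ck_on k S (\<lambda>x. frechet_derivative (\<lambda>x. f x + g x) (at x) v)" for v
    by (intro ck_on_cong[OF \<open>open S\<close> _ sm[of v]]) (simp add: eq)
  then show ?case using der by (auto simp: differentiable_def)
qed

text \<open>
  The product rule expresses the derivative by products of the same kind, so the induction on the
  order of differentiability closes. It covers multiplication, scaling and inner products at once.
\<close>

lemma ck_on_bilinear:
  assumes "open S" "bounded_bilinear b" "ck_on k S f" "ck_on k S g"
  shows "ck_on k S (\<lambda>x. b (f x) (g x))"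
  using assms(3,4)
proof (induction k arbitrary: f g)
  case 0
  then show ?case
    using bounded_bilinear.continuous_on[OF assms(2)] by auto
next
  case (Suc k)
  have der: "((\<lambda>x. b (f x) (g x)) has_derivative
      (\<lambda>v. b (f x) (frechet_derivative g (at x) v) + b (frechet_derivative f (at x) v) (g x)))
      (at x)" if "x \<in> S" for x
    using Suc.prems that
    by (intro bounded_bilinear.FDERIV[OF assms(2)] frechet_derivative_works[THEN iffD1]) auto
  have eq: "frechet_derivative (\<lambda>x. b (f x) (g x)) (at x) v =
      b (f x) (frechet_derivative g (at x) v) + b (frechet_derivative f (at x) v) (g x)"
    if "x \<in> S" for x v
    by (rule frechet_derivative_eq[OF der[OF that]])
  have sm: "ck_on k S (\<lambda>x. b (f x) (frechet_derivative g (at x) v)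
      + b (frechet_derivative f (at x) v) (g x))" for v
    using Suc.prems ck_on_Suc_imp[OF Suc.prems(1)] ck_on_Suc_imp[OF Suc.prems(2)]
    by (intro ck_on_add[OF \<open>open S\<close>] Suc.IH) auto
  have "ck_on k S (\<lambda>x. frechet_derivative (\<lambda>x. b (f x) (g x)) (at x) v)" for v
    by (intro ck_on_cong[OF \<open>open S\<close> _ sm[of v]]) (simp add: eq)
  then show ?case using der by (auto simp: differentiable_def)
qed

lemma ck_on_inverse:
  fixes f :: "'e::euclidean_space \<Rightarrow> real"
  assumes "open S" "\<And>x. x \<in> S \<Longrightarrow> f x \<noteq> 0" "ck_on k S f"
  shows "ck_on k S (\<lambda>x. inverse (f x))"
  using assms(3)
proof (induction k)
  case 0
  then show ?case using assms(2) by (auto intro: continuous_intros)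
next
  case (Suc k)
  note mult = ck_on_bilinear[OF \<open>open S\<close> bounded_bilinear_mult]
  have der: "((\<lambda>x. inverse (f x)) has_derivative
      (\<lambda>v. - (inverse (f x) * frechet_derivative f (at x) v * inverse (f x)))) (at x)"
    if "x \<in> S" for x
    using Suc.prems that assms(2)
    by (intro Deriv.has_derivative_inverse frechet_derivative_works[THEN iffD1]) auto
  have eq: "frechet_derivative (\<lambda>x. inverse (f x)) (at x) v =
      (- 1) * (inverse (f x) * frechet_derivative f (at x) v * inverse (f x))"
    if "x \<in> S" for x v
    using frechet_derivative_eq[OF der[OF that]] by simp
  have sm: "ck_on k S
      (\<lambda>x. (- 1) * (inverse (f x) * frechet_derivative f (at x) v * inverse (f x)))" for v
    using Suc.prems Suc.IH[OF ck_on_Suc_imp[OF Suc.prems]]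
    by (intro mult[of k "\<lambda>x. - 1"] mult[of k _ "\<lambda>x. inverse (f x)"]
        mult[of k "\<lambda>x. inverse (f x)"] ck_on_const) simp_all
  have "ck_on k S (\<lambda>x. frechet_derivative (\<lambda>x. inverse (f x)) (at x) v)" for v
    by (intro ck_on_cong[OF \<open>open S\<close> _ sm[of v]]) (simp add: eq)
  then show ?case using der by (auto simp: differentiable_def)
qed

lemma smooth_on_subset: "smooth_on S f \<Longrightarrow> T \<subseteq> S \<Longrightarrow> smooth_on T f"
  by (meson ck_on_subset smooth_on_def)

lemma smooth_on_cong:
  "\<lbrakk>smooth_on S f; open S; \<And>x. x \<in> S \<Longrightarrow> f x = g x\<rbrakk> \<Longrightarrow> smooth_on S g"
  unfolding smooth_on_def using ck_on_cong[of S f g] by simp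

lemma smooth_on_local:
  "(\<And>x. x \<in> S \<Longrightarrow> \<exists>T. open T \<and> x \<in> T \<and> smooth_on T f) \<Longrightarrow> smooth_on S f"
  unfolding smooth_on_def by (metis ck_on_local)

lemma smooth_on_const: "smooth_on S (\<lambda>x. c)"
  by (simp add: ck_on_const smooth_on_def)

lemma smooth_on_add:
  "\<lbrakk>open S; smooth_on S f; smooth_on S g\<rbrakk> \<Longrightarrow> smooth_on S (\<lambda>x. f x + g x)"
  by (simp add: ck_on_add smooth_on_def)

lemma smooth_on_bilinear:
  "\<lbrakk>open S; bounded_bilinear b; smooth_on S f; smooth_on S g\<rbrakk>
    \<Longrightarrow> smooth_on S (\<lambda>x. b (f x) (g x))"
  by (simp add: ck_on_bilinear smooth_on_def)

lemmas smooth_on_scaleR = smooth_on_bilinear[OF _ bounded_bilinear_scaleR]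
lemmas smooth_on_mult = smooth_on_bilinear[OF _ bounded_bilinear_mult]
lemmas smooth_on_inner = smooth_on_bilinear[OF _ bounded_bilinear_inner]

lemma smooth_on_sum:
  assumes "open S" "finite I" "\<And>i. i \<in> I \<Longrightarrow> smooth_on S (f i)"
  shows "smooth_on S (\<lambda>x. \<Sum>i\<in>I. f i x)"
  using assms(2,3) assms(1)
  by (induction I rule: finite_induct) (auto intro: smooth_on_add smooth_on_const)

lemma smooth_on_divide:
  fixes f g :: "'e::euclidean_space \<Rightarrow> real"
  assumes "open S" "smooth_on S f" "smooth_on S g" "\<And>x. x \<in> S \<Longrightarrow> g x \<noteq> 0"
  shows "smooth_on S (\<lambda>x. f x / g x)"
proof -
  have "smooth_on S (\<lambda>x. inverse (g x))"
    using assms by (simp add: ck_on_inverse smooth_on_def)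
  then show ?thesis
    using smooth_on_mult[of S f "\<lambda>x. inverse (g x)"] assms by (simp add: divide_inverse)
qed

lemma smooth_on_differentiable: "smooth_on S f \<Longrightarrow> x \<in> S \<Longrightarrow> f differentiable (at x)"
  by (metis ck_on.simps(2) smooth_on_def)


section \<open>Coordinates of tangent vectors\<close>

lemma chart_inv_chart_map: "is_chart c \<Longrightarrow> p \<in> chart_dom c \<Longrightarrow> chart_inv c (chart_map c p) = p"
  unfolding is_chart_def homeomorphism_def by auto

lemma open_chart_image:
  assumes "is_chart c" "open U"
  shows "open (chart_map c ` (chart_dom c \<inter> U))"
proof -
  have "openin (top_of_set (chart_map c ` chart_dom c)) (chart_map c ` (chart_dom c \<inter> U))"
    using assms unfolding is_chart_def
    by (intro homeomorphism_imp_open_map[of "chart_dom c" _ _ "chart_inv c"]) auto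
  then show ?thesis
    using assms(1) by (meson is_chart_def openin_open_trans)
qed

context
  fixes M :: "('a::{t2_space, second_countable_topology}, 'e::euclidean_space) manifold"
  assumes M: "smooth_manifold M"
begin

lemma atlas_is_chart: "c \<in> atlas M \<Longrightarrow> is_chart c"
  using M by (simp add: smooth_manifold_def)

lemma chart_at_in_atlas: "chart_at M p \<in> atlas M"
  and in_chart_at: "p \<in> chart_dom (chart_at M p)"
  using M by (auto simp: smooth_manifold_def)

lemma transition_differentiable:
  assumes "c \<in> atlas M" "d \<in> atlas M" "p \<in> chart_dom c" "p \<in> chart_dom d"
  shows "(chart_map d \<circ> chart_inv c) differentiable (at (chart_map c p))"
  using M assms by (intro smooth_on_differentiable) (auto simp: smooth_manifold_def)

lemma has_derivative_comps:
  assumes "c \<in> atlas M" "p \<in> chart_dom c"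
  shows "((chart_map c \<circ> chart_inv (chart_at M p)) has_derivative comps M c p)
    (at (chart_map (chart_at M p) p))"
  unfolding comps_def using assms
  by (metis transition_differentiable frechet_derivative_works chart_at_in_atlas in_chart_at)

lemma has_derivative_of_comps:
  assumes "c \<in> atlas M" "p \<in> chart_dom c"
  shows "((chart_map (chart_at M p) \<circ> chart_inv c) has_derivative of_comps M c p)
    (at (chart_map c p))"
  unfolding of_comps_def using assms
  by (metis transition_differentiable frechet_derivative_works chart_at_in_atlas in_chart_at)

lemma linear_comps: "c \<in> atlas M \<Longrightarrow> p \<in> chart_dom c \<Longrightarrow> linear (comps M c p)"
  using has_derivative_comps has_derivative_linear by blast

lemma linear_of_comps: "c \<in> atlas M \<Longrightarrow> p \<in> chart_dom c \<Longrightarrow> linear (of_comps M c p)"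
  using has_derivative_of_comps has_derivative_linear by blast

text \<open>
  The chain rule: both are derivatives of transition maps between \<open>c\<close> and \<open>chart_at M p\<close>, and the
  composition of these maps is the identity near \<open>p\<close>.
\<close>

lemma of_comps_comps:
  assumes c: "c \<in> atlas M" "p \<in> chart_dom c"
  shows "of_comps M c p (comps M c p v) = v"
proof -
  let ?d = "chart_at M p"
  note d = chart_at_in_atlas[of p] in_chart_at[of p]
  let ?T = "chart_map ?d ` (chart_dom ?d \<inter> chart_dom c)"
  have "((chart_map ?d \<circ> chart_inv c) has_derivative of_comps M c p)
      (at ((chart_map c \<circ> chart_inv ?d) (chart_map ?d p)))"
    using has_derivative_of_comps[OF c] d by (simp add: atlas_is_chart chart_inv_chart_map)
  from diff_chain_at[OF has_derivative_comps[OF c] this]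
  have "((chart_map ?d \<circ> chart_inv c \<circ> (chart_map c \<circ> chart_inv ?d)) has_derivative
      of_comps M c p \<circ> comps M c p) (at (chart_map ?d p))" .
  then have "((\<lambda>x. x) has_derivative of_comps M c p \<circ> comps M c p) (at (chart_map ?d p))"
  proof (rule has_derivative_transform_within_open)
    show "open ?T"
      using c d atlas_is_chart by (intro open_chart_image) (auto simp: is_chart_def)
  qed (use c d in \<open>auto simp: atlas_is_chart chart_inv_chart_map\<close>)
  then have "of_comps M c p \<circ> comps M c p = (\<lambda>x. x)"
    by (rule has_derivative_unique) (rule has_derivative_ident)
  then show ?thesis by (metis comp_apply)
qed

lemma local_rep_chart_map:
  "c \<in> atlas M \<Longrightarrow> p \<in> chart_dom c \<Longrightarrow> local_rep M c X (chart_map c p) = comps M c p (X p)"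
  by (simp add: local_rep_def atlas_is_chart chart_inv_chart_map)


section \<open>Smooth functions and vector fields on open subsets\<close>

definition smooth_fun_on :: "'a set \<Rightarrow> ('a \<Rightarrow> real) \<Rightarrow> bool" where
  "smooth_fun_on U f \<longleftrightarrow>
     (\<forall>c\<in>atlas M. smooth_on (chart_map c ` (chart_dom c \<inter> U)) (f \<circ> chart_inv c))"

text \<open>
  Lets smoothness be checked on a convenient coordinate expression \<open>Y c\<close> of \<open>X\<close>, which may differ from
  \<open>local_rep M c X\<close> away from the image of \<open>chart_dom c \<inter> U\<close>; this is harmless as that image is open.
\<close>

lemma smooth_vf_onI:
  assumes "open U"
    and "\<And>c. c \<in> atlas M \<Longrightarrow> smooth_on (chart_map c ` (chart_dom c \<inter> U)) (Y c)"
    and "\<And>c p. c \<in> atlas M \<Longrightarrow> p \<in> chart_dom c \<Longrightarrow> p \<in> U \<Longrightarrow>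
      Y c (chart_map c p) = comps M c p (X p)"
  shows "smooth_vf_on M U X"
  unfolding smooth_vf_on_def
proof
  fix c assume c: "c \<in> atlas M"
  show "smooth_on (chart_map c ` (chart_dom c \<inter> U)) (local_rep M c X)"
    using assms c
    by (intro smooth_on_cong[OF assms(2)[OF c]] open_chart_image)
      (auto simp: local_rep_chart_map atlas_is_chart)
qed

lemma smooth_vf_on_rep:
  "smooth_vf_on M U X \<Longrightarrow> c \<in> atlas M \<Longrightarrow>
    smooth_on (chart_map c ` (chart_dom c \<inter> U)) (local_rep M c X)"
  by (simp add: smooth_vf_on_def)

lemma smooth_vf_on_subset: "smooth_vf_on M U X \<Longrightarrow> V \<subseteq> U \<Longrightarrow> smooth_vf_on M V X"
  unfolding smooth_vf_on_def by (meson smooth_on_subset Int_mono image_mono order_refl)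

lemma smooth_vf_on_cong:
  assumes "open U" "smooth_vf_on M U X" "\<And>p. p \<in> U \<Longrightarrow> X p = Y p"
  shows "smooth_vf_on M U Y"
  using assms
  by (intro smooth_vf_onI[where Y = "\<lambda>c. local_rep M c X"])
    (auto simp: smooth_vf_on_rep local_rep_chart_map)

lemma smooth_vf_local:
  assumes "\<And>p. \<exists>U. open U \<and> p \<in> U \<and> smooth_vf_on M U X"
  shows "smooth_vf M X"
  unfolding smooth_vf_on_def
proof
  fix c assume c: "c \<in> atlas M"
  show "smooth_on (chart_map c ` (chart_dom c \<inter> UNIV)) (local_rep M c X)"
  proof (rule smooth_on_local)
    fix x assume "x \<in> chart_map c ` (chart_dom c \<inter> UNIV)"
    then obtain p where p: "p \<in> chart_dom c" "x = chart_map c p" by auto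
    obtain U where U: "open U" "p \<in> U" "smooth_vf_on M U X" using assms by blast
    show "\<exists>T. open T \<and> x \<in> T \<and> smooth_on T (local_rep M c X)"
      using p U c open_chart_image[of c U]
      by (intro exI[of _ "chart_map c ` (chart_dom c \<inter> U)"])
        (auto simp: smooth_vf_on_rep atlas_is_chart)
  qed
qed

lemma smooth_vf_on_zero: "open U \<Longrightarrow> smooth_vf_on M U (\<lambda>p. 0)"
  by (rule smooth_vf_onI[where Y = "\<lambda>c x. 0"])
    (auto simp: smooth_on_const linear_comps linear_0)

lemma smooth_vf_on_add:
  assumes "open U" "smooth_vf_on M U X" "smooth_vf_on M U Y"
  shows "smooth_vf_on M U (\<lambda>p. X p + Y p)"
  using assms
  by (intro smooth_vf_onI[where Y = "\<lambda>c x. local_rep M c X x + local_rep M c Y x"])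
    (auto simp: smooth_vf_on_rep local_rep_chart_map linear_comps linear_add atlas_is_chart
      intro!: smooth_on_add open_chart_image)

lemma smooth_vf_on_scale:
  assumes "open U" "smooth_fun_on U f" "smooth_vf_on M U X"
  shows "smooth_vf_on M U (\<lambda>p. f p *\<^sub>R X p)"
  using assms
  by (intro smooth_vf_onI[where Y = "\<lambda>c x. (f \<circ> chart_inv c) x *\<^sub>R local_rep M c X x"])
    (auto simp: smooth_vf_on_rep smooth_fun_on_def local_rep_chart_map linear_comps linear_scale
      atlas_is_chart chart_inv_chart_map simp del: comp_apply
      intro!: smooth_on_scaleR open_chart_image, simp_all add: atlas_is_chart chart_inv_chart_map)

lemma smooth_fun_on_const: "smooth_fun_on U (\<lambda>p. r)"
  by (simp add: smooth_fun_on_def o_def smooth_on_const)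

lemma smooth_vf_on_diff:
  assumes "open U" "smooth_vf_on M U X" "smooth_vf_on M U Y"
  shows "smooth_vf_on M U (\<lambda>p. X p - Y p)"
  using smooth_vf_on_add[OF assms(1,2) smooth_vf_on_scale[OF assms(1) smooth_fun_on_const assms(3)],
      of "- 1"] by simp

lemma smooth_fun_on_divide:
  assumes "open U" "smooth_fun_on U f" "smooth_fun_on U k" "\<And>p. p \<in> U \<Longrightarrow> k p \<noteq> 0"
  shows "smooth_fun_on U (\<lambda>p. f p / k p)"
  unfolding smooth_fun_on_def
proof
  fix c assume c: "c \<in> atlas M"
  have "smooth_on (chart_map c ` (chart_dom c \<inter> U)) (\<lambda>x. (f \<circ> chart_inv c) x / (k \<circ> chart_inv c) x)"
    by (intro smooth_on_divide)
      (use assms c in \<open>auto simp: smooth_fun_on_def o_def open_chart_image atlas_is_chart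
        chart_inv_chart_map\<close>)
  then show "smooth_on (chart_map c ` (chart_dom c \<inter> U)) ((\<lambda>p. f p / k p) \<circ> chart_inv c)"
    by (simp add: o_def)
qed

lemma vf_in_coordinate_basis:
  assumes "c \<in> atlas M" "p \<in> chart_dom c"
  shows "(\<Sum>b\<in>Basis. (local_rep M c X (chart_map c p) \<bullet> b) *\<^sub>R of_comps M c p b) = X p"
proof -
  have "(\<Sum>b\<in>Basis. (comps M c p (X p) \<bullet> b) *\<^sub>R of_comps M c p b)
      = of_comps M c p (\<Sum>b\<in>Basis. (comps M c p (X p) \<bullet> b) *\<^sub>R b)"
    using linear_of_comps[OF assms] by (simp add: linear_sum linear_scale)
  then show ?thesis
    using assms by (simp add: local_rep_chart_map euclidean_representation of_comps_comps)
qed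

text \<open>
  The metric is known to be smooth only on coordinate vector fields, so the general case is reduced to
  these by expanding \<open>X\<close> and \<open>Y\<close> in the coordinate basis: \<open>g(X,Y) = X\<^sup>a Y\<^sup>b g\<^sub>a\<^sub>b\<close>.
\<close>

lemma smooth_fun_on_metric:
  assumes g: "riemannian_metric M g" and U: "open U"
    and X: "smooth_vf_on M U X" and Y: "smooth_vf_on M U Y"
  shows "smooth_fun_on U (\<lambda>p. g p (X p) (Y p))"
  unfolding smooth_fun_on_def
proof
  fix c assume c: "c \<in> atlas M"
  let ?S = "chart_map c ` (chart_dom c \<inter> U)"
  define G where "G a b x = g (chart_inv c x) (of_comps M c (chart_inv c x) a)
    (of_comps M c (chart_inv c x) b)" for a b x
  have S: "open ?S" using c U by (simp add: open_chart_image atlas_is_chart)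
  have G: "smooth_on ?S (G a b)" for a b
    by (rule smooth_on_subset[of "chart_map c ` chart_dom c"])
      (use g c in \<open>auto simp: riemannian_metric_def G_def[abs_def] Let_def\<close>)
  have "smooth_on ?S (\<lambda>x. \<Sum>a\<in>Basis. \<Sum>b\<in>Basis.
      (local_rep M c X x \<bullet> a) * (local_rep M c Y x \<bullet> b) * G a b x)"
    using X Y c by (intro smooth_on_sum smooth_on_mult smooth_on_inner smooth_on_const S G)
      (auto simp: smooth_vf_on_rep)
  then show "smooth_on ?S ((\<lambda>p. g p (X p) (Y p)) \<circ> chart_inv c)"
  proof (rule smooth_on_cong[OF _ S])
    fix x assume "x \<in> ?S"
    then obtain p where p: "p \<in> chart_dom c" "x = chart_map c p" by auto
    have pinv: "chart_inv c x = p" using p c by (simp add: atlas_is_chart chart_inv_chart_map)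
    have bil: "bilinear (g p)" using g by (simp add: riemannian_metric_def)
    have "g p (X p) (Y p) =
        g p (\<Sum>a\<in>Basis. (local_rep M c X x \<bullet> a) *\<^sub>R of_comps M c p a)
            (\<Sum>b\<in>Basis. (local_rep M c Y x \<bullet> b) *\<^sub>R of_comps M c p b)"
      using vf_in_coordinate_basis[OF c p(1)] p(2) by simp
    also have "\<dots> = (\<Sum>a\<in>Basis. \<Sum>b\<in>Basis.
        (local_rep M c X x \<bullet> a) * (local_rep M c Y x \<bullet> b) * G a b x)"
      unfolding bilinear_sum[OF bil] sum.cartesian_product
      by (auto simp: G_def pinv bilinear_lmul[OF bil] bilinear_rmul[OF bil] intro!: sum.cong)
    finally show "(\<Sum>a\<in>Basis. \<Sum>b\<in>Basis.
        (local_rep M c X x \<bullet> a) * (local_rep M c Y x \<bullet> b) * G a b x) =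
        ((\<lambda>p. g p (X p) (Y p)) \<circ> chart_inv c) x"
      by (simp add: pinv)
  qed
qed

lemma smooth_vf_on_endomorphism:
  assumes J: "smooth_endomorphism M J" and U: "open U" and X: "smooth_vf_on M U X"
  shows "smooth_vf_on M U (\<lambda>p. J p (X p))"
proof (rule smooth_vf_onI[OF U])
  let ?A = "\<lambda>c b x. comps M c (chart_inv c x) (J (chart_inv c x) (of_comps M c (chart_inv c x) b))"
  fix c assume c: "c \<in> atlas M"
  let ?S = "chart_map c ` (chart_dom c \<inter> U)"
  have "smooth_on ?S (?A c b)" for b
    by (rule smooth_on_subset[of "chart_map c ` chart_dom c"])
      (use J c in \<open>auto simp: smooth_endomorphism_def Let_def\<close>)
  then show "smooth_on ?S (\<lambda>x. \<Sum>b\<in>Basis. (local_rep M c X x \<bullet> b) *\<^sub>R ?A c b x)"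
    using X c U
    by (intro smooth_on_sum smooth_on_scaleR smooth_on_inner smooth_on_const)
      (auto simp: smooth_vf_on_rep open_chart_image atlas_is_chart)
  fix p assume p: "p \<in> chart_dom c"
  have "linear (J p)" using J by (simp add: smooth_endomorphism_def)
  then have "comps M c p (J p (X p)) =
      (\<Sum>b\<in>Basis. (local_rep M c X (chart_map c p) \<bullet> b) *\<^sub>R comps M c p (J p (of_comps M c p b)))"
    using linear_comps[OF c p]
    by (subst vf_in_coordinate_basis[OF c p, symmetric, of X]) (simp add: linear_sum linear_scale)
  then show "(\<Sum>b\<in>Basis. (local_rep M c X (chart_map c p) \<bullet> b) *\<^sub>R ?A c b (chart_map c p)) =
      comps M c p (J p (X p))"
    using c p by (simp add: atlas_is_chart chart_inv_chart_map)
qed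

end


section \<open>Orthogonal projections\<close>

locale inner_form =
  fixes h :: "'e::euclidean_space \<Rightarrow> 'e \<Rightarrow> real"
  assumes bilin: "bilinear h"
    and sym: "h u v = h v u"
    and pos: "v \<noteq> 0 \<Longrightarrow> h v v > 0"
begin

lemmas h_simps = bilinear_ladd[OF bilin] bilinear_radd[OF bilin] bilinear_lsub[OF bilin]
  bilinear_rsub[OF bilin] bilinear_lmul[OF bilin] bilinear_rmul[OF bilin]
  bilinear_lzero[OF bilin] bilinear_rzero[OF bilin]

lemma null_eq_0: "h v v = 0 \<Longrightarrow> v = 0"
  using pos[of v] by force

lemma subspace_orth_compl: "subspace (orth_compl h S)"
  by (auto simp: subspace_def orth_compl_def h_simps)

lemma orth_decomp_unique:
  assumes "subspace S" "a \<in> S" "a' \<in> S" "x - a \<in> orth_compl h S" "x - a' \<in> orth_compl h S"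
  shows "a = a'"
proof -
  have "a - a' \<in> orth_compl h S"
    using subspace_diff[OF subspace_orth_compl assms(5,4)] by simp
  moreover have "a - a' \<in> S" using assms by (simp add: subspace_diff)
  ultimately show ?thesis using null_eq_0[of "a - a'"] by (simp add: orth_compl_def)
qed

lemma orth_proj_eq:
  assumes "subspace S" "w \<in> S" "x - w \<in> orth_compl h S"
  shows "orth_proj h S x = w" and "orth_proj h (orth_compl h S) x = x - w"
proof -
  show "orth_proj h S x = w"
    unfolding orth_proj_def using assms orth_decomp_unique by blast
  have "w \<in> orth_compl h (orth_compl h S)"
    using assms(2) sym by (auto simp: orth_compl_def)
  then show "orth_proj h (orth_compl h S) x = x - w"
    unfolding orth_proj_def
    using assms(3) by (intro the_equality orth_decomp_unique[OF subspace_orth_compl]) auto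
qed

text \<open>
  If \<open>w\<close> and \<open>c\<close> are the projections of \<open>x\<close> and \<open>a\<close> to \<open>span B\<close>, then \<open>a - c\<close> spans the orthogonal
  complement of \<open>span B\<close> in \<open>span (insert a B)\<close>, and adding the component of \<open>x\<close> along it yields the
  projection to the larger space. If \<open>a\<close> already lies in \<open>span B\<close>, then \<open>a - c = 0\<close> and
  the convention \<open>t / 0 = 0\<close> keeps the formula correct.
\<close>

lemma gram_schmidt_step:
  assumes w: "w \<in> span B" "x - w \<in> orth_compl h (span B)"
    and c: "c \<in> span B" "a - c \<in> orth_compl h (span B)"
  defines "w' \<equiv> w + (h x (a - c) / h (a - c) (a - c)) *\<^sub>R (a - c)"
  shows "w' \<in> span (insert a B)" "x - w' \<in> orth_compl h (span (insert a B))"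
proof -
  define n where "n = a - c"
  define t where "t = h x n / h n n"
  have w': "w' = w + t *\<^sub>R n" by (simp add: w'_def n_def t_def)
  have "span B \<subseteq> span (insert a B)" by (simp add: span_mono subset_insertI)
  then have "w \<in> span (insert a B)" "n \<in> span (insert a B)"
    using w c by (auto simp: n_def intro: span_diff span_base)
  then show "w' \<in> span (insert a B)" by (simp add: w' span_add span_scale)
  have n_orth: "h n s = 0" if "s \<in> span B" for s
    using that c by (simp add: orth_compl_def n_def)
  have res_orth: "h (x - w') s = 0" if "s \<in> span B" for s
    using that w(2) n_orth by (simp add: orth_compl_def w' h_simps)
  have "h w n = 0" using n_orth[OF w(1)] sym by metis
  then have n_res: "h (x - w') n = 0"
    using null_eq_0[of n] by (cases "n = 0") (auto simp: w' t_def h_simps)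
  show "x - w' \<in> orth_compl h (span (insert a B))"
    unfolding orth_compl_def
  proof safe
    fix z assume "z \<in> span (insert a B)"
    then obtain k where k: "z - k *\<^sub>R a \<in> span B" by (auto simp: span_breakdown_eq)
    \<comment> \<open>Since \<open>a = n + c\<close>, the larger span is spanned by \<open>n\<close> and \<open>span B\<close>, and the residue is
      orthogonal to both.\<close>
    have "z = k *\<^sub>R n + ((z - k *\<^sub>R a) + k *\<^sub>R c)" by (simp add: n_def algebra_simps)
    moreover have "(z - k *\<^sub>R a) + k *\<^sub>R c \<in> span B"
      using k c by (simp add: span_add span_scale)
    ultimately show "h (x - w') z = 0"
      using n_res res_orth h_simps(2,6) by (metis add.right_neutral mult_zero_right real_scaleR_def)
  qed
qed

lemma orth_decomp_span: "finite B \<Longrightarrow> \<exists>w\<in>span B. x - w \<in> orth_compl h (span B)"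
proof (induction B arbitrary: x rule: finite_induct)
  case empty
  then show ?case by (auto simp: orth_compl_def h_simps)
next
  case (insert a B)
  then show ?case using gram_schmidt_step by metis
qed

lemma orth_decomp: "subspace S \<Longrightarrow> \<exists>w\<in>S. x - w \<in> orth_compl h S"
  using orth_decomp_span[of _ x] basis_exists[of S] span_subspace
  by (metis finiteI_independent)

end

lemma riemannian_metric_inner_form: "riemannian_metric M g \<Longrightarrow> inner_form (g p)"
  by (auto simp: riemannian_metric_def inner_form_def)

lemma frame_not_in_span:
  fixes f :: "nat \<Rightarrow> 'e::euclidean_space"
  assumes "dim (span (f ` {..<k})) = k" "i < k"
  shows "f i \<notin> span (f ` {..<i})"
proof
  let ?B = "f ` ({..<k} - {i})"
  assume "f i \<in> span (f ` {..<i})"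
  also have "\<dots> \<subseteq> span ?B" using assms(2) by (intro span_mono) auto
  finally have "f ` {..<k} \<subseteq> span ?B" by (auto intro: span_base)
  then have "dim (f ` {..<k}) \<le> card ?B" by (simp add: dim_le_card)
  also have "\<dots> \<le> card ({..<k} - {i})" by (simp add: card_image_le)
  also have "\<dots> < k" using assms(2) by simp
  finally show False using assms(1) by simp
qed

text \<open>
  Induction on the length of the frame, for all fields \<open>Y\<close> at once: the induction hypothesis is needed
  both for \<open>Y\<close> and for the new frame field \<open>E k\<close>, whose residue \<open>N\<close> gives the missing direction. The
  independence assumption says that \<open>N\<close> has no zeros, so dividing by \<open>g(N,N)\<close> is smooth.
\<close>

lemma smooth_projection_to_frame:
  fixes E :: "nat \<Rightarrow> 'a::{t2_space, second_countable_topology} \<Rightarrow> 'e::euclidean_space"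
  assumes M: "smooth_manifold M" and g: "riemannian_metric M g" and U: "open U"
    and "\<And>i. i < k \<Longrightarrow> smooth_vf_on M U (E i)"
    and "\<And>i q. i < k \<Longrightarrow> q \<in> U \<Longrightarrow> E i q \<notin> span ((\<lambda>j. E j q) ` {..<i})"
    and "smooth_vf_on M U Y"
  shows "\<exists>P. smooth_vf_on M U P \<and>
    (\<forall>q\<in>U. P q \<in> span ((\<lambda>j. E j q) ` {..<k}) \<and>
      Y q - P q \<in> orth_compl (g q) (span ((\<lambda>j. E j q) ` {..<k})))"
  using assms(4-)
proof (induction k arbitrary: Y)
  case 0
  show ?case
  proof (intro exI[of _ "\<lambda>q. 0"] conjI ballI)
    show "smooth_vf_on M U (\<lambda>q. 0)" by (rule smooth_vf_on_zero[OF M U])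
  next
    fix q
    interpret inner_form "g q" using g by (rule riemannian_metric_inner_form)
    show "Y q - 0 \<in> orth_compl (g q) (span ((\<lambda>j. E j q) ` {..<0}))"
      by (simp add: orth_compl_def h_simps)
  qed simp
next
  case (Suc k)
  let ?S = "\<lambda>q. span ((\<lambda>j. E j q) ` {..<k})"
  have IH: "\<exists>P. smooth_vf_on M U P \<and> (\<forall>q\<in>U. P q \<in> ?S q \<and> X q - P q \<in> orth_compl (g q) (?S q))"
    if "smooth_vf_on M U X" for X
    using Suc.prems that by (intro Suc.IH) auto
  obtain P where P: "smooth_vf_on M U P"
      "\<And>q. q \<in> U \<Longrightarrow> P q \<in> ?S q \<and> Y q - P q \<in> orth_compl (g q) (?S q)"
    using IH[OF Suc.prems(3)] by blast
  obtain C where C: "smooth_vf_on M U C"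
      "\<And>q. q \<in> U \<Longrightarrow> C q \<in> ?S q \<and> E k q - C q \<in> orth_compl (g q) (?S q)"
    using IH[of "E k"] Suc.prems(1) by blast
  define N where "N q = E k q - C q" for q
  have N: "smooth_vf_on M U N"
    unfolding N_def using Suc.prems(1) C(1) by (intro smooth_vf_on_diff[OF M U]) auto
  have N_nz: "g q (N q) (N q) \<noteq> 0" if "q \<in> U" for q
  proof -
    interpret inner_form "g q" using g by (rule riemannian_metric_inner_form)
    have "N q \<noteq> 0" using C(2)[OF that] Suc.prems(2)[of k q] that by (auto simp: N_def)
    then show ?thesis using pos[of "N q"] by simp
  qed
  define Q where "Q q = P q + (g q (Y q) (N q) / g q (N q) (N q)) *\<^sub>R N q" for q
  have "smooth_vf_on M U Q"
    unfolding Q_def using P N N_nz Suc.prems(3)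
    by (intro smooth_vf_on_add[OF M U] smooth_vf_on_scale[OF M U] smooth_fun_on_divide[OF M U]
        smooth_fun_on_metric[OF M g U]) auto
  moreover have "Q q \<in> span ((\<lambda>j. E j q) ` {..<Suc k}) \<and>
      Y q - Q q \<in> orth_compl (g q) (span ((\<lambda>j. E j q) ` {..<Suc k}))" if "q \<in> U" for q
  proof -
    interpret inner_form "g q" using g by (rule riemannian_metric_inner_form)
    show ?thesis
      using gram_schmidt_step[of "P q" _ "Y q" "C q" "E k q"] P(2)[OF that] C(2)[OF that]
      by (simp add: Q_def N_def lessThan_Suc)
  qed
  ultimately show ?case by blast
qed

lemma subspace_distribution: "distribution M D \<Longrightarrow> subspace (D p)"
  unfolding distribution_def by (metis subspace_span)

text \<open>
  The projection is unique, so it agrees near every point with the one obtained from a local frame,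
  and smoothness is local.
\<close>

lemma smooth_projection_to_distribution:
  assumes M: "smooth_manifold M" and g: "riemannian_metric M g" and D: "distribution M D"
    and Y: "smooth_vf M Y"
    and P: "\<And>q. P q \<in> D q" "\<And>q. Y q - P q \<in> orth_compl (g q) (D q)"
  shows "smooth_vf M P"
proof (rule smooth_vf_local[OF M])
  fix p
  obtain U k E where U: "open U" "p \<in> U"
      and E: "\<And>i::nat. i < k \<Longrightarrow> smooth_vf_on M U (E i)"
      and DE: "\<And>q. q \<in> U \<Longrightarrow> D q = span ((\<lambda>i. E i q) ` {..<k}) \<and> dim (D q) = k"
    using D unfolding distribution_def by metis
  have "E i q \<notin> span ((\<lambda>j. E j q) ` {..<i})" if "i < k" "q \<in> U" for i q
    using frame_not_in_span[of "\<lambda>i. E i q" k i] that DE[OF that(2)] by metis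
  then obtain Q where "smooth_vf_on M U Q"
      "\<forall>q\<in>U. Q q \<in> span ((\<lambda>i. E i q) ` {..<k}) \<and>
        Y q - Q q \<in> orth_compl (g q) (span ((\<lambda>i. E i q) ` {..<k}))"
    using smooth_projection_to_frame[OF M g U(1), of k E Y] E
      smooth_vf_on_subset[OF M Y subset_UNIV] by blast
  then have Q: "smooth_vf_on M U Q"
      "\<And>q. q \<in> U \<Longrightarrow> Q q \<in> D q \<and> Y q - Q q \<in> orth_compl (g q) (D q)"
    using DE by simp_all
  have "Q q = P q" if "q \<in> U" for q
    using inner_form.orth_decomp_unique[OF riemannian_metric_inner_form[OF g]
        subspace_distribution[OF D]] Q(2)[OF that] P by blast
  then have "smooth_vf_on M U P"
    using smooth_vf_on_cong[OF M U(1) Q(1)] by blast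
  then show "\<exists>U. open U \<and> p \<in> U \<and> smooth_vf_on M U P" using U by blast
qed


section \<open>Semi-invariant submersions from Kaehler manifolds\<close>

lemma linear_differential:
  assumes "smooth_manifold M" "smooth_manifold N" "smooth_map M N F"
  shows "linear (differential M N F p)"
proof -
  let ?c = "chart_at M p" and ?d = "chart_at N (F p)"
  have "(chart_map ?d \<circ> F \<circ> chart_inv ?c) differentiable (at (chart_map ?c p))"
    by (rule smooth_on_differentiable[of "chart_map ?c ` (chart_dom ?c \<inter> F -` chart_dom ?d)"])
      (use assms in \<open>auto simp: smooth_map_def chart_at_in_atlas in_chart_at\<close>)
  then show ?thesis
    unfolding differential_def by (rule linear_frechet_derivative)
qed

locale semi_invariant_kaehler_submersion =
  fixes M1 :: "('a::{t2_space, second_countable_topology}, 'e::euclidean_space) manifold"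
    and M2 :: "('b::{t2_space, second_countable_topology}, 'f::euclidean_space) manifold"
    and g1 :: "'a \<Rightarrow> 'e \<Rightarrow> 'e \<Rightarrow> real"
    and g2 :: "'b \<Rightarrow> 'f \<Rightarrow> 'f \<Rightarrow> real"
    and J :: "'a \<Rightarrow> 'e \<Rightarrow> 'e"
    and nabla :: "('a \<Rightarrow> 'e) \<Rightarrow> ('a \<Rightarrow> 'e) \<Rightarrow> 'a \<Rightarrow> 'e"
    and F :: "'a \<Rightarrow> 'b"
    and D1 :: "'a \<Rightarrow> 'e set"
  assumes kaehler: "kaehler_manifold M1 g1 J nabla"
    and semi_inv: "semi_invariant_submersion M1 g1 J M2 g2 F D1"
begin

abbreviation "\<K> \<equiv> vert M1 M2 F"
abbreviation "\<H> \<equiv> horiz M1 g1 M2 F"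
abbreviation "D2 \<equiv> orth_compl_in_vert M1 g1 M2 F D1"
abbreviation "verp \<equiv> ver M1 g1 M2 F"
abbreviation "horp \<equiv> hor M1 g1 M2 F"
abbreviation "\<phi> \<equiv> phi J D1 D2"
abbreviation "\<omega> \<equiv> omega J D1 D2"

lemma manifold: "smooth_manifold M1"
  and metric: "riemannian_metric M1 g1"
  and endomorphism: "smooth_endomorphism M1 J"
  and linear_J: "linear (J p)"
  and J_J: "J p (J p v) = - v"
  and connection: "affine_connection M1 nabla"
  using kaehler
  by (auto simp: kaehler_manifold_def almost_hermitian_manifold_def riemannian_manifold_def
      levi_civita_def smooth_endomorphism_def)

lemma distribution_D1: "distribution M1 D1"
  and D1_vert: "D1 p \<subseteq> \<K> p"
  and vert_splitting: "\<K> p = {v + w | v w. v \<in> D1 p \<and> w \<in> D2 p}"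
  and J_D1: "J p ` D1 p = D1 p"
  and J_D2: "J p ` D2 p \<subseteq> \<H> p"
  using semi_inv unfolding semi_invariant_submersion_def Let_def by blast+

lemma D2_vert: "D2 p \<subseteq> \<K> p"
  by (simp add: orth_compl_in_vert_def)

lemma inner_form_g1: "inner_form (g1 p)"
  using metric by (rule riemannian_metric_inner_form)

lemma subspace_vert: "subspace (\<K> p)"
proof -
  have "linear (differential M1 M2 F p)"
    using semi_inv
    by (intro linear_differential)
      (auto simp: semi_invariant_submersion_def riemannian_submersion_def riemannian_manifold_def)
  then show ?thesis
    by (auto simp: subspace_def vert_def linear_0 linear_add linear_scale)
qed

lemma ver_hor_eq:
  assumes "W p = v + u" "v \<in> \<K> p" "u \<in> \<H> p"
  shows "verp W p = v" "horp W p = u"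
proof -
  interpret inner_form "g1 p" by (rule inner_form_g1)
  show "verp W p = v" "horp W p = u"
    using orth_proj_eq[OF subspace_vert assms(2), of "W p"] assms
    by (auto simp: ver_def hor_def horiz_def)
qed

lemma ver_hor:
  shows "verp W p \<in> \<K> p" "horp W p \<in> \<H> p" "W p = verp W p + horp W p"
proof -
  interpret inner_form "g1 p" by (rule inner_form_g1)
  obtain v where "v \<in> \<K> p" "W p - v \<in> \<H> p"
    using orth_decomp[OF subspace_vert, of p "W p"] unfolding horiz_def by auto
  then show "verp W p \<in> \<K> p" "horp W p \<in> \<H> p" "W p = verp W p + horp W p"
    using ver_hor_eq[of W p v "W p - v"] by simp_all
qed

lemma zero_mem: "0 \<in> \<K> p" "0 \<in> \<H> p"
  using subspace_0[OF subspace_vert] subspace_0[OF inner_form.subspace_orth_compl[OF inner_form_g1]]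
  unfolding horiz_def by auto

lemma ver_hor_add:
  "verp (\<lambda>p. X p + Y p) p = verp X p + verp Y p"
  "horp (\<lambda>p. X p + Y p) p = horp X p + horp Y p"
proof -
  have "verp X p + verp Y p \<in> \<K> p" using ver_hor subspace_vert by (simp add: subspace_add)
  moreover have "horp X p + horp Y p \<in> \<H> p"
    using ver_hor(2) inner_form.subspace_orth_compl[OF inner_form_g1]
    unfolding horiz_def by (simp add: subspace_add)
  moreover have "X p + Y p = (verp X p + verp Y p) + (horp X p + horp Y p)"
    using ver_hor(3)[of X p] ver_hor(3)[of Y p] by simp
  ultimately show "verp (\<lambda>p. X p + Y p) p = verp X p + verp Y p"
    "horp (\<lambda>p. X p + Y p) p = horp X p + horp Y p"
    using ver_hor_eq[of "\<lambda>p. X p + Y p" p] by simp_all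
qed

lemma ver_hor_of_vert:
  assumes "\<And>p. X p \<in> \<K> p"
  shows "verp X = X" "horp X = (\<lambda>p. 0)"
  using ver_hor_eq[of X p "X p" 0 for p] assms zero_mem by (simp_all add: fun_eq_iff)

lemma ver_hor_of_horiz:
  assumes "\<And>p. X p \<in> \<H> p"
  shows "verp X = (\<lambda>p. 0)" "horp X = X"
  using ver_hor_eq[of X p 0 "X p" for p] assms zero_mem by (simp_all add: fun_eq_iff)

lemma ver_hor_zero: "verp (\<lambda>p. 0) p = 0" "horp (\<lambda>p. 0) p = 0"
  using ver_hor_of_vert[of "\<lambda>p. 0"] zero_mem by simp_all

text \<open>
  If \<open>V = v + w\<close> with \<open>v\<close> in \<open>D\<^sub>1\<close> and \<open>w\<close> in \<open>D\<^sub>2\<close>, the two components of \<open>J V\<close> are \<open>J v\<close> and \<open>J w\<close>. They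
  are unique because \<open>D\<^sub>1\<close> is vertical and \<open>J D\<^sub>2\<close> horizontal.
\<close>

lemma phi_omega:
  assumes "V p \<in> \<K> p"
  shows "\<phi> V p \<in> D1 p" "\<omega> V p \<in> J p ` D2 p" "J p (V p) = \<phi> V p + \<omega> V p"
proof -
  interpret inner_form "g1 p" by (rule inner_form_g1)
  obtain v w where vw: "v \<in> D1 p" "w \<in> D2 p" "V p = v + w"
    using assms vert_splitting by blast
  let ?a = "J p v" and ?b = "J p w"
  have a: "?a \<in> D1 p" using vw J_D1 by blast
  have b: "?b \<in> J p ` D2 p" using vw by blast
  have sum: "J p (V p) = ?a + ?b" using vw linear_J by (simp add: linear_add)
  have uniq: "x = ?a" if "x \<in> D1 p" "J p (V p) - x \<in> J p ` D2 p" for x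
    using orth_decomp_unique[OF subspace_vert, of x p ?a "J p (V p)"] that a b sum
      D1_vert[of p] J_D2[of p]
    by (auto simp: horiz_def)
  have "\<phi> V p = ?a"
    unfolding phi_def
  proof (rule the_equality)
    show "?a \<in> D1 p \<and> J p (V p) - ?a \<in> J p ` D2 p" using a b sum by simp
  qed (use uniq in blast)
  moreover have "\<omega> V p = ?b"
    unfolding omega_def
  proof (rule the_equality)
    fix y assume "y \<in> J p ` D2 p \<and> J p (V p) - y \<in> D1 p"
    then have "J p (V p) - y = ?a" using uniq[of "J p (V p) - y"] by simp
    then show "y = ?b" using sum by (simp add: algebra_simps)
  qed (use a b sum in simp)
  ultimately show "\<phi> V p \<in> D1 p" "\<omega> V p \<in> J p ` D2 p" "J p (V p) = \<phi> V p + \<omega> V p"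
    using a b sum by auto
qed

text \<open>
  As \<open>\<omega>V\<close> is horizontal, it is orthogonal to \<open>D\<^sub>1\<close>, so \<open>\<phi>V\<close> is the orthogonal projection of
  \<open>J V\<close> to \<open>D\<^sub>1\<close>.
\<close>

lemma smooth_phi_omega:
  assumes V: "V \<in> sections M1 \<K>"
  shows "smooth_vf M1 (\<phi> V)" "smooth_vf M1 (\<omega> V)"
proof -
  have VK: "V p \<in> \<K> p" for p using V by (simp add: sections_def)
  have JV: "smooth_vf M1 (\<lambda>p. J p (V p))"
    using V smooth_vf_on_endomorphism[OF manifold endomorphism open_UNIV] by (simp add: sections_def)
  have \<omega>_eq: "\<omega> V = (\<lambda>p. J p (V p) - \<phi> V p)"
    using phi_omega(3)[of V, OF VK] by (auto simp: algebra_simps)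
  show \<phi>: "smooth_vf M1 (\<phi> V)"
  proof (rule smooth_projection_to_distribution[OF manifold metric distribution_D1 JV])
    fix p
    show "\<phi> V p \<in> D1 p" by (rule phi_omega(1)[where p=p]) (rule VK)
    have "\<omega> V p \<in> orth_compl (g1 p) (\<K> p)"
      using phi_omega(2)[of V p, OF VK] J_D2 by (auto simp: horiz_def)
    then show "J p (V p) - \<phi> V p \<in> orth_compl (g1 p) (D1 p)"
      using D1_vert[of p] \<omega>_eq by (auto simp: orth_compl_def)
  qed
  show "smooth_vf M1 (\<omega> V)"
    unfolding \<omega>_eq using smooth_vf_on_diff[OF manifold open_UNIV JV \<phi>] .
qed

lemma nabla_zero:
  assumes "smooth_vf M1 X"
  shows "nabla X (\<lambda>p. 0) = (\<lambda>p. 0)"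
proof -
  have z: "smooth_vf M1 (\<lambda>p. 0)" by (rule smooth_vf_on_zero[OF manifold open_UNIV])
  have "nabla X (\<lambda>p. 0 + 0) = (\<lambda>p. nabla X (\<lambda>p. 0) p + nabla X (\<lambda>p. 0) p)"
    using connection assms z unfolding affine_connection_def by blast
  then have "nabla X (\<lambda>p. 0) p + nabla X (\<lambda>p. 0) p = nabla X (\<lambda>p. 0) p" for p
    by (metis add.right_neutral)
  then show ?thesis by auto
qed

text \<open>
  Parallelism of \<open>J\<close> turns \<open>W\<close> into the sum of the derivatives of \<open>\<phi>X\<^sub>2\<close> and \<open>\<omega>X\<^sub>2\<close>. In O'Neill's tensor
  the horizontal part of \<open>\<phi>X\<^sub>2\<close> and the vertical part of \<open>\<omega>X\<^sub>2\<close> vanish, which leaves precisely the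
  projections of these two derivatives.
\<close>

lemma gauss_weingarten:
  assumes X1: "X1 \<in> sections M1 \<K>" and X2: "X2 \<in> sections M1 \<K>"
  defines "W \<equiv> \<lambda>p. J p (nabla X1 X2 p)"
  shows "oneill_T M1 g1 nabla M2 F X1 (\<phi> X2) p + horp (nabla X1 (\<omega> X2)) p = horp W p"
    and "nabla_hat M1 g1 nabla M2 F X1 (\<phi> X2) p + oneill_T M1 g1 nabla M2 F X1 (\<omega> X2) p
      = verp W p"
proof -
  have sm: "smooth_vf M1 X1" "smooth_vf M1 X2" using X1 X2 by (auto simp: sections_def)
  have vert: "X1 p \<in> \<K> p" "X2 p \<in> \<K> p" for p using X1 X2 by (auto simp: sections_def)
  have \<phi>_vert: "\<phi> X2 p \<in> \<K> p" for p
    using phi_omega(1)[of X2 p, OF vert(2)] D1_vert by blast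
  have \<omega>_horiz: "\<omega> X2 p \<in> \<H> p" for p
    using phi_omega(2)[of X2 p, OF vert(2)] J_D2 by blast
  have "W = nabla X1 (\<lambda>q. J q (X2 q))"
    using kaehler sm unfolding kaehler_manifold_def cov_deriv_endo_def W_def by auto
  also have "\<dots> = nabla X1 (\<lambda>q. \<phi> X2 q + \<omega> X2 q)"
    using phi_omega(3)[of X2, OF vert(2)] by simp
  also have "\<dots> = (\<lambda>p. nabla X1 (\<phi> X2) p + nabla X1 (\<omega> X2) p)"
    using connection sm(1) smooth_phi_omega[OF X2] unfolding affine_connection_def by blast
  finally have W: "W = (\<lambda>p. nabla X1 (\<phi> X2) p + nabla X1 (\<omega> X2) p)" .
  note simps = ver_hor_of_vert[OF vert(1)] ver_hor_of_vert[OF \<phi>_vert]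
    ver_hor_of_horiz[OF \<omega>_horiz] nabla_zero[OF sm(1)] ver_hor_zero
  show "oneill_T M1 g1 nabla M2 F X1 (\<phi> X2) p + horp (nabla X1 (\<omega> X2)) p = horp W p"
    unfolding W ver_hor_add oneill_T_def by (simp add: simps)
  show "nabla_hat M1 g1 nabla M2 F X1 (\<phi> X2) p + oneill_T M1 g1 nabla M2 F X1 (\<omega> X2) p
      = verp W p"
    unfolding W ver_hor_add oneill_T_def nabla_hat_def by (simp add: simps)
qed

text \<open>
  Applying \<open>J\<close> once more: \<open>z = - J a - J b\<close>, and \<open>J\<close> maps \<open>D\<^sub>1\<close> to itself and \<open>J D\<^sub>2\<close> back to \<open>D\<^sub>2\<close>.
\<close>

lemma vert_of_J_decomp:
  assumes "J p z = a + b" "a \<in> D1 p" "b \<in> J p ` D2 p"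
  shows "z \<in> \<K> p"
proof -
  obtain d where d: "d \<in> D2 p" "b = J p d" using assms(3) by blast
  have "J p a \<in> \<K> p" "d \<in> \<K> p" using assms(2) J_D1 D1_vert D2_vert d by blast+
  moreover have "z = d - J p a"
    using J_J[of p z] J_J[of p d] assms(1) d linear_J[of p] by (simp add: linear_add algebra_simps)
  ultimately show ?thesis using subspace_vert by (simp add: subspace_diff)
qed

text \<open>
  For vertical \<open>Z\<close> the two parts of \<open>J Z\<close> are \<open>\<omega>Z\<close> and \<open>\<phi>Z\<close>, so their smoothness comes from
  \<open>smooth_phi_omega\<close>.
\<close>

lemma section_vert_iff:
  assumes Z: "smooth_vf M1 Z"
  defines "W \<equiv> \<lambda>p. J p (Z p)"
  shows "Z \<in> sections M1 \<K> \<longleftrightarrow>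
    (\<lambda>p. horp W p) \<in> sections M1 (\<lambda>p. J p ` D2 p) \<and> (\<lambda>p. verp W p) \<in> sections M1 D1"
proof
  assume Zs: "Z \<in> sections M1 \<K>"
  then have ZK: "Z p \<in> \<K> p" for p by (simp add: sections_def)
  have "verp W p = \<phi> Z p" "horp W p = \<omega> Z p" for p
    using ver_hor_eq[of W p "\<phi> Z p" "\<omega> Z p"] phi_omega[of Z p, OF ZK] D1_vert[of p] J_D2[of p]
    by (auto simp: W_def)
  then show "(\<lambda>p. horp W p) \<in> sections M1 (\<lambda>p. J p ` D2 p) \<and> (\<lambda>p. verp W p) \<in> sections M1 D1"
    using phi_omega[of Z, OF ZK] smooth_phi_omega[OF Zs] by (simp add: sections_def)
next
  assume "(\<lambda>p. horp W p) \<in> sections M1 (\<lambda>p. J p ` D2 p) \<and> (\<lambda>p. verp W p) \<in> sections M1 D1"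
  then have "Z p \<in> \<K> p" for p
    using vert_of_J_decomp[of p "Z p" "verp W p" "horp W p"] ver_hor(3)[of W p]
    by (simp add: sections_def W_def)
  then show "Z \<in> sections M1 \<K>" using Z by (simp add: sections_def)
qed

end

theorem proposition3p6:
  fixes M1 :: "('a::{t2_space, second_countable_topology}, 'e::euclidean_space) manifold"
    and M2 :: "('b::{t2_space, second_countable_topology}, 'f::euclidean_space) manifold"
    and g1 :: "'a \<Rightarrow> 'e \<Rightarrow> 'e \<Rightarrow> real"
    and g2 :: "'b \<Rightarrow> 'f \<Rightarrow> 'f \<Rightarrow> real"
    and J :: "'a \<Rightarrow> 'e \<Rightarrow> 'e"
    and nabla :: "('a \<Rightarrow> 'e) \<Rightarrow> ('a \<Rightarrow> 'e) \<Rightarrow> 'a \<Rightarrow> 'e"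
    and F :: "'a \<Rightarrow> 'b"
    and D1 D2 :: "'a \<Rightarrow> 'e set"
  assumes "riemannian_manifold M2 g2"
    and "levi_civita M1 g1 nabla"
    and "kaehler_manifold M1 g1 J nabla"
    and "semi_invariant_submersion M1 g1 J M2 g2 F D1"
    and "D2 = orth_compl_in_vert M1 g1 M2 F D1"
  shows "totally_geodesic_foliation M1 nabla (vert M1 M2 F) \<longleftrightarrow>
    (\<forall>X1 \<in> sections M1 (vert M1 M2 F). \<forall>X2 \<in> sections M1 (vert M1 M2 F).
       (\<lambda>p. oneill_T M1 g1 nabla M2 F X1 (phi J D1 D2 X2) p
            + hor M1 g1 M2 F (nabla X1 (omega J D1 D2 X2)) p)
         \<in> sections M1 (\<lambda>p. J p ` D2 p) \<and>
       (\<lambda>p. nabla_hat M1 g1 nabla M2 F X1 (phi J D1 D2 X2) p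
            + oneill_T M1 g1 nabla M2 F X1 (omega J D1 D2 X2) p)
         \<in> sections M1 D1)"
proof -
  interpret semi_invariant_kaehler_submersion M1 M2 g1 g2 J nabla F D1
    using assms by unfold_locales
  have "nabla X1 X2 \<in> sections M1 (vert M1 M2 F) \<longleftrightarrow>
       (\<lambda>p. oneill_T M1 g1 nabla M2 F X1 (phi J D1 D2 X2) p
            + hor M1 g1 M2 F (nabla X1 (omega J D1 D2 X2)) p)
         \<in> sections M1 (\<lambda>p. J p ` D2 p) \<and>
       (\<lambda>p. nabla_hat M1 g1 nabla M2 F X1 (phi J D1 D2 X2) p
            + oneill_T M1 g1 nabla M2 F X1 (omega J D1 D2 X2) p)
         \<in> sections M1 D1"
    if X: "X1 \<in> sections M1 (vert M1 M2 F)" "X2 \<in> sections M1 (vert M1 M2 F)" for X1 X2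
  proof -
    have "smooth_vf M1 (nabla X1 X2)"
      using connection X by (simp add: affine_connection_def sections_def)
    then show ?thesis
      unfolding assms(5) gauss_weingarten[OF X] by (rule section_vert_iff)
  qed
  then show ?thesis unfolding totally_geodesic_foliation_def by blast
qed

end
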